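(* Let $V\in\mathbb{R}^{n\times p}$ have full column rank $p<n$, let $A\in\mathbb{R}^{n\times n}$ be symmetric of full rank $n$, and set $L_\varepsilon=\varepsilon A+VV^\top$, where $L_\varepsilon$ is positive semi-definite for all sufficiently small $\varepsilon>0$. Let $0\le m\le n$ and let $\mathcal{X}_\varepsilon\sim|DPP|_m(L_\varepsilon)$. Then, as $\varepsilon\to0^+$, $\mathcal{X}_\varepsilon$ converges in distribution to a point process $\mathcal{X}_\star$ with $$\mathcal{X}_\star\sim\begin{cases}|DPP|_m(VV^\top),&\text{if } m\le p,\\ |DPP|_m(A;V),&\text{if } m>p.\end{cases}$$
   Context: All matrices are real. The ground set is $\Omega$, identified with $\{1,\dots,n\}$; a point process is a random subset of $\Omega$. For a matrix $B$ and index set $X$, $B_X$ is the principal submatrix indexed by $X$, and $B_{X,:}$ keeps the rows in $X$ and all columns. The determinant of an empty matrix is $1$. Convergence of point processes on the finite set $\Omega$ means convergence of $\mathbf{P}(\mathcal{X}_\varepsilon=X)$ for every $X\subseteq\Omega$. Fixed-size L-ensemble: for $L\in\mathbb{R}^{n\times n}$ symmetric positive semi-definite, $\mathcal{X}\sim|DPP|_m(L)$ means $\mathbf{P}(\mathcal{X}=X)\propto\det(L_X)$ if $|X|=m$, and $0$ otherwise. Nonnegative pair (NNP): a pair $(L;V)$ with $L\in\mathbb{R}^{n\times n}$ symmetric, $V\in\mathbb{R}^{n\times p}$ of full column rank, $0\le p\le n$, and $x^\top Lx\ge0$ for all $x$ with $V^\top x=0$. Fixed-size extended L-ensemble: for an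 NNP $(L;V)$, $\mathcal{X}\sim|DPP|_m(L;V)$ means $$\mathbf{P}(\mathcal{X}=X)\propto(-1)^p\det\begin{pmatrix}L_X&V_{X,:}\\(V_{X,:})^\top&0\end{pmatrix}$$ if $|X|=m$, and $0$ otherwise. *)

theory Defs
  imports
    "HOL-Probability.Probability_Mass_Function"
    "Jordan_Normal_Form.DL_Rank"
    "Jordan_Normal_Form.DL_Submatrix"
begin

hide_const (open) Determinants.det

text \<open>
  The ground set is \<open>{..<n}\<close>, since rows and columns of matrices are numbered from 0.
  A point process is represented by its law, a \<open>nat set pmf\<close>: \<open>pmf D X\<close> is the
  probability that the random subset equals \<open>X\<close>.
\<close>

definition point_process :: "nat \<Rightarrow> nat set pmf \<Rightarrow> bool" where
  "point_process n D \<longleftrightarrow> set_pmf D \<subseteq> Pow {..<n}"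

definition converges_in_distribution ::
    "nat \<Rightarrow> ('a \<Rightarrow> nat set pmf) \<Rightarrow> nat set pmf \<Rightarrow> 'a filter \<Rightarrow> bool" where
  "converges_in_distribution n D D' F \<longleftrightarrow>
     (\<forall>X \<subseteq> {..<n}. ((\<lambda>e. pmf (D e) X) \<longlongrightarrow> pmf D' X) F)"

definition symmetric_mat :: "nat \<Rightarrow> real mat \<Rightarrow> bool" where
  "symmetric_mat n L \<longleftrightarrow> L \<in> carrier_mat n n \<and> transpose_mat L = L"

definition psd_mat :: "nat \<Rightarrow> real mat \<Rightarrow> bool" where
  "psd_mat n L \<longleftrightarrow> symmetric_mat n L \<and>
     (\<forall>x \<in> carrier_vec n. 0 \<le> scalar_prod x (L *\<^sub>v x))"

definition full_column_rank :: "nat \<Rightarrow> nat \<Rightarrow> real mat \<Rightarrow> bool" where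
  "full_column_rank n p V \<longleftrightarrow> V \<in> carrier_mat n p \<and> vec_space.rank n V = p"

definition nonneg_pair :: "nat \<Rightarrow> nat \<Rightarrow> real mat \<Rightarrow> real mat \<Rightarrow> bool" where
  "nonneg_pair n p L V \<longleftrightarrow> symmetric_mat n L \<and> full_column_rank n p V \<and> p \<le> n \<and>
     (\<forall>x \<in> carrier_vec n. transpose_mat V *\<^sub>v x = 0\<^sub>v p \<longrightarrow> 0 \<le> scalar_prod x (L *\<^sub>v x))"

text \<open>
  Being a probability distribution, \<open>D\<close> determines the constant of proportionality \<open>c\<close>;
  no such \<open>D\<close> exists if all the weights of subsets of size \<open>m\<close> vanish.
\<close>

definition fixed_size_law :: "nat \<Rightarrow> nat \<Rightarrow> (nat set \<Rightarrow> real) \<Rightarrow> nat set pmf \<Rightarrow> bool" where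
  "fixed_size_law n m w D \<longleftrightarrow> point_process n D \<and>
     (\<exists>c > 0. \<forall>X \<subseteq> {..<n}. pmf D X = (if card X = m then c * w X else 0))"

definition fixed_size_L_ensemble :: "nat \<Rightarrow> nat \<Rightarrow> real mat \<Rightarrow> nat set pmf \<Rightarrow> bool" where
  "fixed_size_L_ensemble n m L D \<longleftrightarrow> psd_mat n L \<and>
     fixed_size_law n m (\<lambda>X. det (submatrix L X X)) D"

definition ext_weight :: "nat \<Rightarrow> real mat \<Rightarrow> real mat \<Rightarrow> nat set \<Rightarrow> real" where
  "ext_weight p L V X =
     (let V\<^sub>X = submatrix V X UNIV
      in (- 1) ^ p * det (four_block_mat (submatrix L X X) V\<^sub>X (transpose_mat V\<^sub>X) (0\<^sub>m p p)))"

definition fixed_size_ext_L_ensemble ::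
    "nat \<Rightarrow> nat \<Rightarrow> nat \<Rightarrow> real mat \<Rightarrow> real mat \<Rightarrow> nat set pmf \<Rightarrow> bool" where
  "fixed_size_ext_L_ensemble n p m L V D \<longleftrightarrow> nonneg_pair n p L V \<and>
     fixed_size_law n m (ext_weight p L V) D"

end

theory Submission
  imports Defs "Jordan_Normal_Form.DL_Rank_Submatrix"
begin

text \<open>
  The weight of \<open>X\<close> under \<open>|DPP|\<^sub>m(L\<^sub>\<epsilon>)\<close> is the minor \<open>det (\<epsilon>A\<^sub>X + V\<^sub>X V\<^sub>X\<^sup>T)\<close>, and the law is
  obtained by dividing by the sum of these minors over all \<open>X\<close> of size \<open>m\<close>.  Hence the laws
  converge as soon as the weights, all multiplied by one positive factor depending on \<open>\<epsilon>\<close> only,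
  converge to limits that are not all zero; the limits are then automatically non-negative and
  are the weights of the limiting law (\<open>fixed_size_law_limit\<close>).

  For \<open>m \<le> p\<close> no factor is needed: the minors are continuous in \<open>\<epsilon>\<close> and tend to
  \<open>det (V\<^sub>X V\<^sub>X\<^sup>T)\<close>.  For \<open>m > p\<close> these limits vanish, since \<open>V\<^sub>X V\<^sub>X\<^sup>T\<close> has rank at most \<open>p\<close>.  A block
  elimination (\<open>det_add_gram_eq_bordered\<close>) gives, for \<open>\<epsilon> > 0\<close>, the exact identity

    \<open>\<epsilon>\<^sup>p / \<epsilon>\<^sup>m * det (\<epsilon>A\<^sub>X + V\<^sub>X V\<^sub>X\<^sup>T) = (-1)\<^sup>p det [[A\<^sub>X, V\<^sub>X], [V\<^sub>X\<^sup>T, -\<epsilon>I]]\<close>,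

  whose right-hand side tends to the weight of \<open>X\<close> under \<open>|DPP|\<^sub>m(A;V)\<close>.

  It remains to find a set \<open>X\<close> of size \<open>m\<close> whose limiting weight is non-zero.  As \<open>V\<close> has full
  column rank, it has \<open>k\<close> independent rows for every \<open>k \<le> p\<close> (\<open>exists_independent_rows\<close>).
  For \<open>m \<le> p\<close>, the index set \<open>X\<close> of \<open>m\<close> independent rows makes the Gram matrix \<open>V\<^sub>X V\<^sub>X\<^sup>T\<close> definite.
  For \<open>m > p\<close>, any \<open>X\<close> containing the indices of \<open>p\<close> independent rows works: \<open>V\<^sub>X\<close> is then
  injective, and a bordered matrix with injective border is non-singular if \<open>A\<close> is definite on
  the kernel of \<open>V\<^sup>T\<close>.  This definiteness is where the positivity of \<open>L\<^sub>\<epsilon>\<close> and the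
  invertibility of \<open>A\<close> meet (\<open>pos_def_on_kernel\<close>): a vector \<open>x\<close> with \<open>V\<^sup>Tx = 0\<close> and \<open>x\<^sup>TAx = 0\<close> is
  isotropic for the semi-definite matrix \<open>L\<^sub>\<epsilon>\<close>, hence in its kernel, so \<open>\<epsilon>Ax = L\<^sub>\<epsilon>x = 0\<close>.
\<close>

unbundle no vec_syntax
unbundle no inner_syntax

section \<open>Limits of fixed-size laws\<close>

text \<open>
  The unknown constant of proportionality is eliminated by the requirement that the
  probabilities sum to one.
\<close>

lemma fixed_size_law_normalized:
  assumes law: "fixed_size_law n m w D" and X: "X \<subseteq> {..<n}" "card X = m"
  shows "0 \<le> w X"
    and "pmf D X = w X / (\<Sum>Y | Y \<subseteq> {..<n} \<and> card Y = m. w Y)"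
proof -
  let ?P = "{Y. Y \<subseteq> {..<n} \<and> card Y = m}"
  obtain c where c: "c > 0"
    and D: "\<And>Y. Y \<subseteq> {..<n} \<Longrightarrow> pmf D Y = (if card Y = m then c * w Y else 0)"
    and supp: "set_pmf D \<subseteq> Pow {..<n}"
    using law by (auto simp: fixed_size_law_def point_process_def)
  have "0 \<le> c * w X" using D[OF X(1)] X(2) by (metis pmf_nonneg)
  then show "0 \<le> w X" using c by (simp add: zero_le_mult_iff)
  have "1 = (\<Sum>Y\<in>Pow {..<n}. pmf D Y)"
    using sum_pmf_eq_1[OF _ supp] by simp
  also have "\<dots> = (\<Sum>Y\<in>Pow {..<n}. if card Y = m then c * w Y else 0)"
    using D by (intro sum.cong) auto
  also have "\<dots> = (\<Sum>Y\<in>?P. c * w Y)"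
    by (subst sum.inter_filter[symmetric]) (auto intro: sum.cong)
  finally have "c * (\<Sum>Y\<in>?P. w Y) = 1" by (simp add: sum_distrib_left)
  then have "c = 1 / (\<Sum>Y\<in>?P. w Y)" by (metis mult_eq_0_iff nonzero_eq_divide_eq zero_neq_one)
  then show "pmf D X = w X / (\<Sum>Y\<in>?P. w Y)" using D[OF X(1)] X(2) by simp
qed

text \<open>
  The factor \<open>s e\<close> cancels in the normalized probabilities of \<open>fixed_size_law_normalized\<close>, so it
  may compensate a common rate at which the weights vanish.  The limit weights inherit
  non-negativity from the probabilities, so a single non-zero one makes their sum positive.
\<close>

lemma fixed_size_law_limit:
  fixes w :: "'a \<Rightarrow> nat set \<Rightarrow> real" and s :: "'a \<Rightarrow> real"
  assumes F: "F \<noteq> bot"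
    and law: "\<forall>\<^sub>F e in F. fixed_size_law n m (w e) (D e)"
    and s: "\<forall>\<^sub>F e in F. s e > 0"
    and lim: "\<And>X. X \<subseteq> {..<n} \<Longrightarrow> card X = m \<Longrightarrow> ((\<lambda>e. s e * w e X) \<longlongrightarrow> w' X) F"
    and X0: "X0 \<subseteq> {..<n}" "card X0 = m" "w' X0 \<noteq> 0"
  obtains D' where "converges_in_distribution n D D' F" and "fixed_size_law n m w' D'"
proof -
  define P where "P = {X. X \<subseteq> {..<n} \<and> card X = m}"
  define Z where "Z = (\<Sum>X\<in>P. w' X)"
  define f where "f X = (if X \<in> P then w' X / Z else 0)" for X
  have fin: "finite P" unfolding P_def by simp
  have nonneg: "0 \<le> w' X" if "X \<in> P" for X
  proof (rule tendsto_lowerbound[OF lim _ F])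
    show "X \<subseteq> {..<n}" "card X = m" using that by (auto simp: P_def)
    show "\<forall>\<^sub>F e in F. 0 \<le> s e * w e X"
      using law s
      by eventually_elim (use that fixed_size_law_normalized(1) in \<open>auto simp: P_def\<close>)
  qed
  have "X0 \<in> P" using X0 by (simp add: P_def)
  then have Z: "Z > 0"
    unfolding Z_def using X0(3) nonneg fin by (intro sum_pos2[where i = X0]) (auto simp: less_le)
  have f0: "0 \<le> f X" for X using nonneg Z by (simp add: f_def)
  have "(\<integral>\<^sup>+X. ennreal (f X) \<partial>count_space UNIV) = (\<Sum>X\<in>P. ennreal (f X))"
    using fin by (intro nn_integral_count_space') (auto simp: f_def)
  also have "\<dots> = ennreal (\<Sum>X\<in>P. f X)" using f0 by (simp add: sum_ennreal)
  also have "(\<Sum>X\<in>P. f X) = 1"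
    using Z by (simp add: f_def sum_divide_distrib[symmetric] Z_def[symmetric])
  finally have int1: "(\<integral>\<^sup>+X. ennreal (f X) \<partial>count_space UNIV) = 1" by simp
  define D' where "D' = embed_pmf f"
  have D': "pmf D' X = f X" for X unfolding D'_def by (rule pmf_embed_pmf[OF f0 int1])
  have "fixed_size_law n m w' D'"
    unfolding fixed_size_law_def point_process_def
  proof (intro conjI exI[of _ "1 / Z"] allI impI)
    show "set_pmf D' \<subseteq> Pow {..<n}" by (auto simp: set_pmf_eq D' f_def P_def split: if_splits)
    show "1 / Z > 0" using Z by simp
    show "pmf D' X = (if card X = m then 1 / Z * w' X else 0)" if "X \<subseteq> {..<n}" for X
      using that by (auto simp: D' f_def P_def)
  qed
  moreover have "converges_in_distribution n D D' F"
    unfolding converges_in_distribution_def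
  proof (intro allI impI)
    fix X assume X: "X \<subseteq> {..<n}"
    show "((\<lambda>e. pmf (D e) X) \<longlongrightarrow> pmf D' X) F"
    proof (cases "card X = m")
      case True
      have "((\<lambda>e. s e * w e X / (\<Sum>Y\<in>P. s e * w e Y)) \<longlongrightarrow> w' X / Z) F"
        unfolding Z_def
        by (intro tendsto_divide tendsto_sum lim X True)
          (use Z in \<open>auto simp: P_def Z_def\<close>)
      moreover have "\<forall>\<^sub>F e in F. s e * w e X / (\<Sum>Y\<in>P. s e * w e Y) = pmf (D e) X"
        using law s
        by eventually_elim
          (use fixed_size_law_normalized(2)[OF _ X True] in
            \<open>simp add: sum_distrib_left[symmetric] P_def\<close>)
      moreover have "pmf D' X = w' X / Z" using X True by (simp add: D' f_def P_def)
      ultimately show ?thesis by (simp add: tendsto_cong)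
    next
      case False
      have "\<forall>\<^sub>F e in F. pmf (D e) X = 0"
        using law by eventually_elim (use X False in \<open>auto simp: fixed_size_law_def\<close>)
      then show ?thesis using False by (simp add: D' f_def P_def tendsto_eventually)
    qed
  qed
  ultimately show thesis using that by blast
qed

section \<open>Submatrices and vectors supported on a set of indices\<close>

definition supported_on :: "nat set \<Rightarrow> real vec \<Rightarrow> bool" where
  "supported_on X x \<longleftrightarrow> (\<forall>i<dim_vec x. i \<notin> X \<longrightarrow> x $ i = 0)"

text \<open>
  Extension by zero turns statements about a submatrix into statements about the full
  matrix acting on vectors supported on \<open>X\<close>.  Entry \<open>k\<close> of \<open>u\<close> goes to position \<open>pick X k\<close>,
  the convention by which \<open>submatrix\<close> numbers its rows and columns.
\<close>

definition extend_vec :: "nat \<Rightarrow> nat set \<Rightarrow> real vec \<Rightarrow> real vec" where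
  "extend_vec n X u = vec n (\<lambda>i. if i \<in> X then u $ card {a \<in> X. a < i} else 0)"

lemma restrict_index_set: "X \<subseteq> {..<n::nat} \<Longrightarrow> {i. i < n \<and> i \<in> X} = X"
  by auto

lemma card_below_less:
  assumes "X \<subseteq> {..<n::nat}" "i \<in> X"
  shows "card {a \<in> X. a < i} < card X"
proof (rule psubset_card_mono)
  show "finite X" using assms(1) finite_subset by blast
qed (use assms(2) in auto)

lemma extend_vec_carrier [simp]: "extend_vec n X u \<in> carrier_vec n"
  by (simp add: extend_vec_def)

lemma supported_on_extend_vec [simp]: "supported_on X (extend_vec n X u)"
  by (simp add: supported_on_def extend_vec_def)

lemma extend_vec_eq_zeroD:
  assumes X: "X \<subseteq> {..<n}" and u: "u \<in> carrier_vec (card X)"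
    and z: "extend_vec n X u = 0\<^sub>v n"
  shows "u = 0\<^sub>v (card X)"
proof (rule eq_vecI)
  fix k assume "k < dim_vec (0\<^sub>v (card X) :: real vec)"
  then have k: "k < card X" by simp
  have pk: "pick X k \<in> X" using k pick_in_set by blast
  then have "extend_vec n X u $ pick X k = u $ k"
    using X card_pick k by (auto simp: extend_vec_def)
  then show "u $ k = 0\<^sub>v (card X) $ k" using z k pk X by auto
qed (use u in auto)

lemma submatrix_cols_mult_vec:
  assumes A: "A \<in> carrier_mat r n" and X: "X \<subseteq> {..<n}" and u: "u \<in> carrier_vec (card X)"
  shows "submatrix A UNIV X *\<^sub>v u = A *\<^sub>v extend_vec n X u"
proof (rule eq_vecI)
  have dims: "dim_row (submatrix A UNIV X) = r" "dim_col (submatrix A UNIV X) = card X"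
    using A X by (simp_all add: dim_submatrix restrict_index_set)
  show "dim_vec (submatrix A UNIV X *\<^sub>v u) = dim_vec (A *\<^sub>v extend_vec n X u)"
    using dims A by simp
  fix i assume "i < dim_vec (A *\<^sub>v extend_vec n X u)"
  then have i: "i < r" using A by simp
  have "(A *\<^sub>v extend_vec n X u) $ i = (\<Sum>j<n. A $$ (i, j) * extend_vec n X u $ j)"
    using A i by (simp add: scalar_prod_def extend_vec_def atLeast0LessThan)
  also have "\<dots> = (\<Sum>j\<in>X. A $$ (i, j) * u $ card {a \<in> X. a < j})"
    using X by (intro sum.mono_neutral_cong_right) (auto simp: extend_vec_def)
  also have "\<dots> = (\<Sum>k<card X. A $$ (i, pick X k) * u $ k)"
    by (rule sum.reindex_bij_witness[where i = "pick X" and j = "\<lambda>j. card {a \<in> X. a < j}"])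
      (use card_pick pick_in_set pick_card_in_set card_below_less[OF X] in auto)
  also have "\<dots> = (submatrix A UNIV X *\<^sub>v u) $ i"
    using A i u X dims
    by (simp add: scalar_prod_def atLeast0LessThan submatrix_def restrict_index_set pick_UNIV)
  finally show "(submatrix A UNIV X *\<^sub>v u) $ i = (A *\<^sub>v extend_vec n X u) $ i" by simp
qed

lemma submatrix_mult_vec_index:
  assumes A: "A \<in> carrier_mat r n" and I: "I \<subseteq> {..<r}" and X: "X \<subseteq> {..<n}"
    and u: "u \<in> carrier_vec (card X)" and i: "i \<in> I"
  shows "(submatrix A I X *\<^sub>v u) $ card {a \<in> I. a < i} = (A *\<^sub>v extend_vec n X u) $ i"
proof -
  let ?k = "card {a \<in> I. a < i}"
  have k: "?k < card I" by (rule card_below_less[OF I i])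
  have "(submatrix A I X *\<^sub>v u) $ ?k = row (submatrix A I X) ?k \<bullet> u"
    using A I k by (simp add: dim_submatrix restrict_index_set)
  also have "row (submatrix A I X) ?k = row (submatrix A UNIV X) i"
    using A I k pick_card_in_set[OF i]
    by (subst submatrix_split, subst row_submatrix_UNIV) (auto simp: dim_submatrix restrict_index_set)
  also have "\<dots> \<bullet> u = (submatrix A UNIV X *\<^sub>v u) $ i"
    using A I i by (auto simp: dim_submatrix)
  finally show ?thesis using submatrix_cols_mult_vec[OF A X u] by simp
qed

lemma submatrix_rows_mult_vec_index:
  assumes A: "A \<in> carrier_mat r n" and I: "I \<subseteq> {..<r}" and i: "i \<in> I"
  shows "(submatrix A I UNIV *\<^sub>v v) $ card {a \<in> I. a < i} = (A *\<^sub>v v) $ i"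
  using A I i card_below_less[OF I i] pick_card_in_set[OF i]
  by (subst index_mult_mat_vec) (auto simp: dim_submatrix restrict_index_set row_submatrix_UNIV)

lemma transpose_submatrix: "transpose_mat (submatrix A I J) = submatrix (transpose_mat A) J I"
  by (intro eq_matI) (auto simp: dim_submatrix submatrix_def pick_le)

lemma scalar_prod_eq_zero_if_supported_on:
  assumes "x \<in> carrier_vec n" "y \<in> carrier_vec n" "supported_on X x"
    and "\<And>i. i < n \<Longrightarrow> i \<in> X \<Longrightarrow> y $ i = 0"
  shows "x \<bullet> y = 0"
  using assms by (auto simp: scalar_prod_def supported_on_def intro!: sum.neutral)

section \<open>Quadratic forms and kernels\<close>

lemma scalar_prod_self_nonneg: "0 \<le> x \<bullet> (x :: real vec)"
  by (auto simp: scalar_prod_def intro: sum_nonneg)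

lemma scalar_prod_self_eq_zeroD:
  assumes "x \<in> carrier_vec n" "x \<bullet> x = (0::real)"
  shows "x = 0\<^sub>v n"
  using assms by (auto simp: scalar_prod_def sum_nonneg_eq_0_iff intro!: eq_vecI)

lemma mat_mult_zero_vec: "B \<in> carrier_mat r k \<Longrightarrow> B *\<^sub>v 0\<^sub>v k = (0\<^sub>v r :: real vec)"
  by (intro eq_vecI) auto

lemma zero_mat_mult_vec: "v \<in> carrier_vec k \<Longrightarrow> 0\<^sub>m r k *\<^sub>v v = (0\<^sub>v r :: real vec)"
  by (intro eq_vecI) auto

lemma det_nonzeroI:
  fixes M :: "'a :: field mat"
  assumes "M \<in> carrier_mat k k"
    and "\<And>u. u \<in> carrier_vec k \<Longrightarrow> M *\<^sub>v u = 0\<^sub>v k \<Longrightarrow> u = 0\<^sub>v k"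
  shows "det M \<noteq> 0"
  using det_0_iff_vec_prod_zero_field[OF assms(1)] assms(2) by blast

lemma quadratic_form_gram:
  assumes V: "V \<in> carrier_mat n p" and x: "x \<in> carrier_vec n"
  shows "x \<bullet> ((V * transpose_mat V) *\<^sub>v x)
    = (transpose_mat V *\<^sub>v x) \<bullet> (transpose_mat V *\<^sub>v (x :: real vec))"
  using V x transpose_vec_mult_scalar[OF V, of "transpose_mat V *\<^sub>v x" x]
  by (simp add: assoc_mult_mat_vec[where n\<^sub>2 = p])

lemma add_gram_mult_vec:
  assumes A: "A \<in> carrier_mat n n" and V: "V \<in> carrier_mat n p" and x: "x \<in> carrier_vec n"
  shows "(e \<cdot>\<^sub>m A + V * transpose_mat V) *\<^sub>v x
    = e \<cdot>\<^sub>v (A *\<^sub>v x) + V *\<^sub>v (transpose_mat V *\<^sub>v (x :: real vec))"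
  using A V x
  by (subst add_mult_distrib_mat_vec[where nr = n and nc = n])
    (auto simp: assoc_mult_mat_vec[where n\<^sub>2 = p] intro!: eq_vecI)

lemma quadratic_form_add_gram:
  assumes A: "A \<in> carrier_mat n n" and V: "V \<in> carrier_mat n p" and x: "x \<in> carrier_vec n"
  shows "x \<bullet> ((e \<cdot>\<^sub>m A + V * transpose_mat V) *\<^sub>v x)
    = e * (x \<bullet> (A *\<^sub>v x)) + (transpose_mat V *\<^sub>v x) \<bullet> (transpose_mat V *\<^sub>v (x :: real vec))"
  using A V x transpose_vec_mult_scalar[OF V, of "transpose_mat V *\<^sub>v x" x]
  by (simp add: add_gram_mult_vec[OF A V x] scalar_prod_add_distrib[where n = n])

text \<open>
  If \<open>y = L x\<close> were non-zero, moving from \<open>x\<close> a little in the direction \<open>-y\<close> would make the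
  form negative: the linear term \<open>-2t (y \<bullet> y)\<close> dominates the quadratic one for small \<open>t\<close>.
\<close>

lemma psd_mat_isotropic_in_kernel:
  assumes L: "psd_mat n L" and x: "x \<in> carrier_vec n" and iso: "x \<bullet> (L *\<^sub>v x) = 0"
  shows "L *\<^sub>v x = 0\<^sub>v n"
proof -
  have Lc: "L \<in> carrier_mat n n" and sym: "transpose_mat L = L"
    and psd: "\<And>z. z \<in> carrier_vec n \<Longrightarrow> 0 \<le> z \<bullet> (L *\<^sub>v z)"
    using L by (auto simp: psd_mat_def symmetric_mat_def)
  define y where "y = L *\<^sub>v x"
  have y: "y \<in> carrier_vec n" using Lc x by (simp add: y_def)
  define a where "a = y \<bullet> y"
  define b where "b = y \<bullet> (L *\<^sub>v y)"
  have xLy: "x \<bullet> (L *\<^sub>v y) = a"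
    using transpose_vec_mult_scalar[OF Lc y x] sym by (simp add: y_def a_def)
  have expand: "0 \<le> t * t * b - 2 * t * a" for t
  proof -
    have "L *\<^sub>v (x + (-t) \<cdot>\<^sub>v y) = y + (-t) \<cdot>\<^sub>v (L *\<^sub>v y)"
      using Lc x y by (simp add: mult_add_distrib_mat_vec[where nc = n] mult_mat_vec y_def)
    moreover have "(x + (-t) \<cdot>\<^sub>v y) \<bullet> (y + (-t) \<cdot>\<^sub>v (L *\<^sub>v y))
        = x \<bullet> y + (-t) * (x \<bullet> (L *\<^sub>v y)) + (-t) * (y \<bullet> y) + (-t) * (-t) * (y \<bullet> (L *\<^sub>v y))"
      using Lc x y
      by (simp add: add_scalar_prod_distrib[where n = n] scalar_prod_add_distrib[where n = n]
          algebra_simps)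
    ultimately show ?thesis
      using psd[of "x + (-t) \<cdot>\<^sub>v y"] x y xLy iso
      by (simp add: a_def b_def y_def[symmetric])
  qed
  have "a = 0"
  proof (rule ccontr)
    assume "a \<noteq> 0"
    then have a: "a > 0" using scalar_prod_self_nonneg[of y] by (simp add: a_def)
    \<comment> \<open>small enough that \<open>t * b \<le> a\<close>, also when \<open>b = 0\<close>\<close>
    define t where "t = a / (\<bar>b\<bar> + 1)"
    have t: "t > 0" using a by (simp add: t_def)
    have "0 \<le> t * (t * b - 2 * a)" using expand[of t] by (simp add: algebra_simps)
    then have "2 * a \<le> t * b" using t by (simp add: zero_le_mult_iff)
    also have "\<dots> \<le> t * (\<bar>b\<bar> + 1)" using t by (intro mult_left_mono) auto
    also have "\<dots> = a" by (simp add: t_def)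
    finally show False using a by simp
  qed
  then show ?thesis using scalar_prod_self_eq_zeroD[OF y] by (simp add: a_def y_def)
qed

lemma gram_psd:
  assumes V: "V \<in> carrier_mat n p"
  shows "psd_mat n (V * transpose_mat V)"
  unfolding psd_mat_def symmetric_mat_def
proof (intro conjI ballI)
  show "transpose_mat (V * transpose_mat V) = V * transpose_mat V"
    using V by (subst transpose_mult[where nr = n and n = p and nc = n]) auto
  show "V * transpose_mat V \<in> carrier_mat n n" using V by simp
  fix x :: "real vec" assume x: "x \<in> carrier_vec n"
  show "0 \<le> x \<bullet> ((V * transpose_mat V) *\<^sub>v x)"
    by (simp add: quadratic_form_gram[OF V x] scalar_prod_self_nonneg)
qed

text \<open>
  Only semi-definiteness on the kernel is immediate, and invertibility of \<open>A\<close> alone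
  would not improve it: the invertible matrix \<open>[[0, 1], [1, 0]]\<close> vanishes as a quadratic form on
  the kernel of \<open>[1, 0]\<close>.  Semi-definiteness of \<open>eA + VV\<^sup>T\<close> on the whole space excludes this, as
  isotropic vectors of a semi-definite form lie in its kernel.
\<close>

lemma pos_def_on_kernel:
  assumes V: "V \<in> carrier_mat n p" and A: "A \<in> carrier_mat n n" and rank: "vec_space.rank n A = n"
    and e: "e > 0" and psd: "psd_mat n (e \<cdot>\<^sub>m A + V * transpose_mat V)"
    and x: "x \<in> carrier_vec n" and ker: "transpose_mat V *\<^sub>v x = 0\<^sub>v p"
  shows "0 \<le> x \<bullet> (A *\<^sub>v x)" and "x \<bullet> (A *\<^sub>v x) = 0 \<Longrightarrow> x = 0\<^sub>v n"
proof -
  let ?L = "e \<cdot>\<^sub>m A + V * transpose_mat V"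
  have form: "x \<bullet> (?L *\<^sub>v x) = e * (x \<bullet> (A *\<^sub>v x))"
    by (simp add: quadratic_form_add_gram[OF A V x] ker)
  have "0 \<le> x \<bullet> (?L *\<^sub>v x)" using psd x by (simp add: psd_mat_def)
  then show "0 \<le> x \<bullet> (A *\<^sub>v x)" using e by (simp add: form zero_le_mult_iff)
  assume "x \<bullet> (A *\<^sub>v x) = 0"
  then have "?L *\<^sub>v x = 0\<^sub>v n" using psd_mat_isotropic_in_kernel[OF psd x] by (simp add: form)
  moreover note add_gram_mult_vec[OF A V x, of e]
  ultimately have e0: "e \<cdot>\<^sub>v (A *\<^sub>v x) = 0\<^sub>v n" using A x ker by (simp add: mat_mult_zero_vec[OF V])
  have "A *\<^sub>v x = 0\<^sub>v n"
  proof (rule eq_vecI)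
    fix i assume "i < dim_vec (0\<^sub>v n :: real vec)"
    then show "(A *\<^sub>v x) $ i = 0\<^sub>v n $ i"
      using arg_cong[OF e0, of "\<lambda>v. v $ i"] A e by simp
  qed (use A in simp)
  moreover have "det A \<noteq> 0" using vec_space.det_rank_iff[OF A] rank by blast
  ultimately show "x = 0\<^sub>v n" using det_0_iff_vec_prod_zero_field[OF A] x by blast
qed

section \<open>Selecting independent rows\<close>

text \<open>
  The rank is the dimension of the span of the \<^emph>\<open>set\<close> of columns, so the columns must be
  shown to be distinct before their independence can be turned into injectivity.
\<close>

lemma full_column_rank_injective:
  assumes rank: "full_column_rank n p V" and v: "v \<in> carrier_vec p" and Vv: "V *\<^sub>v v = 0\<^sub>v n"
  shows "v = 0\<^sub>v p"
proof (rule ccontr)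
  assume nz: "v \<noteq> 0\<^sub>v p"
  have V: "V \<in> carrier_mat n p" and r: "vec_space.rank n V = p"
    using rank by (auto simp: full_column_rank_def)
  interpret vec_space "TYPE(real)" n .
  obtain S where S: "maximal S (\<lambda>T. T \<subseteq> set (cols V) \<and> lin_indpt T)"
    using maximal_exists_superset[of "set (cols V)" "\<lambda>T. T \<subseteq> set (cols V) \<and> lin_indpt T" "{}"]
      finite_lin_indpt2[of "{}"] by auto
  have "p \<le> card (set (cols V))"
    using rank_card_indpt[OF V S] r S by (auto simp: maximal_def intro: card_mono)
  then have "distinct (cols V)"
    using V card_length[of "cols V"] by (intro card_distinct) auto
  then show False
    using lin_depI[OF V v nz Vv] full_rank_lin_indpt[OF V r] by blast
qed

text \<open>
  Independence of the rows indexed by \<open>Y\<close> is expressed by the row combinations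
  \<open>V\<^sup>T x\<close> with \<open>x\<close> supported on \<open>Y\<close>.  As long as \<open>m < p\<close> rows are chosen, some non-zero \<open>v\<close> is
  orthogonal to all of them; since \<open>V v \<noteq> 0\<close>, some further row is not orthogonal to \<open>v\<close>, and pairing
  a vanishing combination with \<open>v\<close> shows that this row is independent of the others.
\<close>

lemma exists_independent_rows:
  assumes V: "V \<in> carrier_mat n p"
    and inj: "\<And>v. v \<in> carrier_vec p \<Longrightarrow> V *\<^sub>v v = 0\<^sub>v n \<Longrightarrow> v = 0\<^sub>v p"
    and m: "m \<le> p"
  shows "\<exists>Y \<subseteq> {..<n}. card Y = m \<and>
    (\<forall>x \<in> carrier_vec n. supported_on Y x \<longrightarrow> transpose_mat V *\<^sub>v x = 0\<^sub>v p \<longrightarrow> x = 0\<^sub>v n)"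
  using m
proof (induction m)
  case 0
  show ?case
    by (intro exI[of _ "{}"]) (auto simp: supported_on_def intro!: eq_vecI)
next
  case (Suc m)
  then obtain Y where Y: "Y \<subseteq> {..<n}" "card Y = m"
    and indep: "\<And>x. x \<in> carrier_vec n \<Longrightarrow> supported_on Y x \<Longrightarrow> transpose_mat V *\<^sub>v x = 0\<^sub>v p
      \<Longrightarrow> x = 0\<^sub>v n"
    by auto
  have fY: "finite Y" using Y(1) finite_subset by blast
  \<comment> \<open>the chosen rows, filled up to a square matrix by zero rows, at least one since \<open>m < p\<close>\<close>
  define M where "M = mat p p (\<lambda>(k, j). if k < m then V $$ (pick Y k, j) else 0)"
  have M: "M \<in> carrier_mat p p" by (simp add: M_def)
  have "transpose_mat M *\<^sub>v unit_vec p m = 0\<^sub>v p"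
    using Suc.prems by (intro eq_vecI) (auto simp: M_def)
  moreover have "unit_vec p m \<noteq> (0\<^sub>v p :: real vec)"
    using Suc.prems by (auto dest: arg_cong[of _ _ "\<lambda>v. v $ m"])
  ultimately have "det (transpose_mat M) = 0"
    using det_0_iff_vec_prod_zero_field[of "transpose_mat M" p] M unit_vec_carrier
      transpose_carrier_mat by blast
  then obtain v where v: "v \<in> carrier_vec p" "v \<noteq> 0\<^sub>v p" and Mv: "M *\<^sub>v v = 0\<^sub>v p"
    using det_0_iff_vec_prod_zero_field[OF M] det_transpose[OF M] by auto
  have orth: "(V *\<^sub>v v) $ i = 0" if i: "i \<in> Y" for i
  proof -
    let ?k = "card {a \<in> Y. a < i}"
    have k: "?k < m" using card_below_less[OF Y(1) i] Y(2) by simp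
    have "(V *\<^sub>v v) $ i = (M *\<^sub>v v) $ ?k"
      using V v i Y k Suc.prems pick_card_in_set[OF i]
      by (auto simp: M_def scalar_prod_def intro!: sum.cong)
    then show ?thesis using Mv k Suc.prems by simp
  qed
  have "V *\<^sub>v v \<noteq> 0\<^sub>v n" using inj v by blast
  then obtain i where i: "i < n" "(V *\<^sub>v v) $ i \<noteq> 0"
    using V by (metis eq_vecI dim_mult_mat_vec carrier_matD(1) index_zero_vec)
  then have iY: "i \<notin> Y" using orth by blast
  show ?case
  proof (intro exI[of _ "insert i Y"] conjI ballI impI)
    show "insert i Y \<subseteq> {..<n}" using i Y by simp
    show "card (insert i Y) = Suc m" using iY Y fY by simp
    fix x assume x: "x \<in> carrier_vec n" "supported_on (insert i Y) x"
      and ker: "transpose_mat V *\<^sub>v x = 0\<^sub>v p"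
    have "0 = (transpose_mat V *\<^sub>v x) \<bullet> v" using v by (simp add: ker)
    also have "\<dots> = x \<bullet> (V *\<^sub>v v)" by (rule transpose_vec_mult_scalar[OF V v(1) x(1)])
    also have "\<dots> = (\<Sum>j<n. x $ j * (V *\<^sub>v v) $ j)"
      using V by (simp add: scalar_prod_def atLeast0LessThan)
    also have "\<dots> = (\<Sum>j\<in>{i}. x $ j * (V *\<^sub>v v) $ j)"
      using i x orth by (intro sum.mono_neutral_right) (auto simp: supported_on_def)
    finally have "x $ i = 0" using i by simp
    then have "supported_on Y x" using x(2) by (auto simp: supported_on_def)
    then show "x = 0\<^sub>v n" using indep x ker by blast
  qed
qed

text \<open>For a square matrix, independence of the rows is injectivity.\<close>

lemma independent_rows_span:
  assumes V: "V \<in> carrier_mat n p" and Y: "Y \<subseteq> {..<n}" "card Y = p"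
    and indep: "\<And>x. x \<in> carrier_vec n \<Longrightarrow> supported_on Y x \<Longrightarrow> transpose_mat V *\<^sub>v x = 0\<^sub>v p
      \<Longrightarrow> x = 0\<^sub>v n"
    and v: "v \<in> carrier_vec p" and zero: "\<And>i. i \<in> Y \<Longrightarrow> (V *\<^sub>v v) $ i = 0"
  shows "v = 0\<^sub>v p"
proof -
  let ?S = "submatrix V Y UNIV"
  have S: "?S \<in> carrier_mat p p"
    using V Y by (intro carrier_matI) (auto simp: dim_submatrix restrict_index_set)
  have "det (transpose_mat ?S) \<noteq> 0"
  proof (rule det_nonzeroI)
    show "transpose_mat ?S \<in> carrier_mat p p" using S by simp
    fix u :: "real vec" assume u: "u \<in> carrier_vec p" and z: "transpose_mat ?S *\<^sub>v u = 0\<^sub>v p"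
    have "transpose_mat V *\<^sub>v extend_vec n Y u = 0\<^sub>v p"
      using submatrix_cols_mult_vec[of "transpose_mat V" p n Y u] V Y u z
      by (simp add: transpose_submatrix)
    then have "extend_vec n Y u = 0\<^sub>v n" by (intro indep) simp_all
    then show "u = 0\<^sub>v p" using extend_vec_eq_zeroD[OF Y(1), of u] u Y(2) by simp
  qed
  then have "det ?S \<noteq> 0" by (simp add: det_transpose[OF S])
  moreover have "?S *\<^sub>v v = 0\<^sub>v p"
  proof (rule eq_vecI)
    fix k assume "k < dim_vec (0\<^sub>v p :: real vec)"
    then have k: "k < card Y" using Y by simp
    have pk: "pick Y k \<in> Y" "card {a \<in> Y. a < pick Y k} = k"
      using k pick_in_set card_pick by auto
    show "(?S *\<^sub>v v) $ k = 0\<^sub>v p $ k"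
      using submatrix_rows_mult_vec_index[OF V Y(1) pk(1), of v] zero[OF pk(1)] pk(2) k Y by simp
  qed (use S in simp)
  ultimately show ?thesis using det_0_iff_vec_prod_zero_field[OF S] v by blast
qed

section \<open>Non-vanishing minors\<close>

lemma principal_minor_nonzero:
  assumes L: "L \<in> carrier_mat n n" and X: "X \<subseteq> {..<n}"
    and definite: "\<And>x. x \<in> carrier_vec n \<Longrightarrow> supported_on X x \<Longrightarrow> x \<bullet> (L *\<^sub>v x) = 0 \<Longrightarrow> x = 0\<^sub>v n"
  shows "det (submatrix L X X) \<noteq> 0"
proof (rule det_nonzeroI)
  show "submatrix L X X \<in> carrier_mat (card X) (card X)"
    using L X by (intro carrier_matI) (auto simp: dim_submatrix restrict_index_set)
  fix u assume u: "u \<in> carrier_vec (card X)" and z: "submatrix L X X *\<^sub>v u = 0\<^sub>v (card X)"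
  let ?x = "extend_vec n X u"
  have "(L *\<^sub>v ?x) $ i = 0" if "i \<in> X" for i
    using submatrix_mult_vec_index[OF L X X u that] card_below_less[OF X that] z by simp
  then have "?x \<bullet> (L *\<^sub>v ?x) = 0"
    using L by (intro scalar_prod_eq_zero_if_supported_on[where n = n and X = X])
      (auto simp del: index_mult_mat_vec)
  then have "?x = 0\<^sub>v n" by (intro definite) simp_all
  then show "u = 0\<^sub>v (card X)" by (rule extend_vec_eq_zeroD[OF X u])
qed

text \<open>
  A kernel vector \<open>(u, v)\<close> of the bordered matrix satisfies \<open>L\<^sub>X u + V\<^sub>X v = 0\<close> and \<open>V\<^sub>X\<^sup>T u = 0\<close>.
  Pairing the first equation with \<open>u\<close> removes \<open>v\<close> and makes the extension of \<open>u\<close> isotropic in the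
  kernel of \<open>V\<^sup>T\<close>, so \<open>u = 0\<close>; what remains is \<open>V\<^sub>X v = 0\<close>.
\<close>

lemma ext_weight_nonzero:
  assumes L: "L \<in> carrier_mat n n" and V: "V \<in> carrier_mat n p" and X: "X \<subseteq> {..<n}"
    and definite: "\<And>x. x \<in> carrier_vec n \<Longrightarrow> supported_on X x \<Longrightarrow> transpose_mat V *\<^sub>v x = 0\<^sub>v p
      \<Longrightarrow> x \<bullet> (L *\<^sub>v x) = 0 \<Longrightarrow> x = 0\<^sub>v n"
    and spanning: "\<And>v. v \<in> carrier_vec p \<Longrightarrow> (\<And>i. i \<in> X \<Longrightarrow> (V *\<^sub>v v) $ i = 0) \<Longrightarrow> v = 0\<^sub>v p"
  shows "ext_weight p L V X \<noteq> 0"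
proof -
  let ?k = "card X" and ?W = "submatrix V X UNIV" and ?LX = "submatrix L X X"
  let ?M = "four_block_mat ?LX ?W (transpose_mat ?W) (0\<^sub>m p p)"
  have LX: "?LX \<in> carrier_mat ?k ?k" and W: "?W \<in> carrier_mat ?k p"
    using L V X by (auto intro!: carrier_matI simp: dim_submatrix restrict_index_set)
  have "det ?M \<noteq> 0"
  proof (rule det_nonzeroI)
    show "?M \<in> carrier_mat (?k + p) (?k + p)" using LX by simp
    fix z assume z: "z \<in> carrier_vec (?k + p)" and Mz: "?M *\<^sub>v z = 0\<^sub>v (?k + p)"
    define u v where "u = vec_first z ?k" and "v = vec_last z p"
    have u: "u \<in> carrier_vec ?k" and v: "v \<in> carrier_vec p" and zuv: "z = u @\<^sub>v v"
      using z by (auto simp: u_def v_def)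
    have "(?LX *\<^sub>v u + ?W *\<^sub>v v) @\<^sub>v (transpose_mat ?W *\<^sub>v u + 0\<^sub>m p p *\<^sub>v v) = ?M *\<^sub>v z"
      unfolding zuv using LX W u v by (intro four_block_mat_mult_vec[symmetric]) auto
    also have "\<dots> = 0\<^sub>v ?k @\<^sub>v 0\<^sub>v p" unfolding Mz by auto
    finally have "?LX *\<^sub>v u + ?W *\<^sub>v v = 0\<^sub>v ?k \<and> transpose_mat ?W *\<^sub>v u + 0\<^sub>m p p *\<^sub>v v = 0\<^sub>v p"
      using LX W u v by (subst (asm) append_vec_eq[where n = ?k]) auto
    then have top: "?LX *\<^sub>v u + ?W *\<^sub>v v = 0\<^sub>v ?k" and bot: "transpose_mat ?W *\<^sub>v u = 0\<^sub>v p"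
      using W u zero_mat_mult_vec[OF v] by auto
    let ?x = "extend_vec n X u"
    have ker: "transpose_mat V *\<^sub>v ?x = 0\<^sub>v p"
      using submatrix_cols_mult_vec[of "transpose_mat V" p n X u] V X u bot
      by (simp add: transpose_submatrix)
    have stat: "(L *\<^sub>v ?x) $ i + (V *\<^sub>v v) $ i = 0" if i: "i \<in> X" for i
      using arg_cong[OF top, of "\<lambda>y. y $ card {a \<in> X. a < i}"] card_below_less[OF X i] W LX
        submatrix_mult_vec_index[OF L X X u i] submatrix_rows_mult_vec_index[OF V X i, of v]
      by simp
    have "?x \<bullet> (L *\<^sub>v ?x + V *\<^sub>v v) = 0"
    proof (rule scalar_prod_eq_zero_if_supported_on)
      show "L *\<^sub>v ?x + V *\<^sub>v v \<in> carrier_vec n"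
        using v by (intro add_carrier_vec mult_mat_vec_carrier[OF L] mult_mat_vec_carrier[OF V]) auto
      show "(L *\<^sub>v ?x + V *\<^sub>v v) $ i = 0" if "i < n" "i \<in> X" for i
        using stat[OF that(2)] that(1) V by (simp del: index_mult_mat_vec)
    qed auto
    moreover have "?x \<bullet> (V *\<^sub>v v) = 0"
      using transpose_vec_mult_scalar[OF V v, of ?x] ker v by simp
    ultimately have "?x \<bullet> (L *\<^sub>v ?x) = 0"
      using L V v by (simp add: scalar_prod_add_distrib[where n = n])
    then have x0: "?x = 0\<^sub>v n" using ker by (intro definite) simp_all
    then have "u = 0\<^sub>v ?k" using extend_vec_eq_zeroD[OF X u] by blast
    moreover have "v = 0\<^sub>v p"
    proof (rule spanning[OF v])
      fix i assume i: "i \<in> X"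
      then have "i < n" using X by auto
      then show "(V *\<^sub>v v) $ i = 0" using stat[OF i] unfolding x0 mat_mult_zero_vec[OF L] by simp
    qed
    ultimately show "z = 0\<^sub>v (?k + p)" unfolding zuv by auto
  qed
  then show ?thesis by (simp add: ext_weight_def Let_def)
qed

section \<open>Asymptotics of the minors\<close>

lemma tendsto_det:
  fixes f :: "'a \<Rightarrow> real mat"
  assumes f: "\<And>e. f e \<in> carrier_mat k k" and g: "g \<in> carrier_mat k k"
    and lim: "\<And>i j. i < k \<Longrightarrow> j < k \<Longrightarrow> ((\<lambda>e. f e $$ (i, j)) \<longlongrightarrow> g $$ (i, j)) F"
  shows "((\<lambda>e. det (f e)) \<longlongrightarrow> det g) F"
  unfolding det_def'[OF f] det_def'[OF g]
  by (intro tendsto_sum tendsto_mult tendsto_const tendsto_prod lim)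
    (auto dest: permutes_in_image)

text \<open>
  This is the Schur complement with respect to the block \<open>-eI\<close>.  Both sides are the determinant of
  the product of the bordered matrix with a block triangular matrix, chosen to clear the lower
  left block without dividing by \<open>e\<close>.
\<close>

lemma det_add_gram_eq_bordered:
  fixes e :: real
  assumes B: "B \<in> carrier_mat k k" and W: "W \<in> carrier_mat k p"
  shows "e ^ k * det (four_block_mat B W (transpose_mat W) ((- e) \<cdot>\<^sub>m 1\<^sub>m p))
    = (- e) ^ p * det (e \<cdot>\<^sub>m B + W * transpose_mat W)"
proof -
  let ?M = "four_block_mat B W (transpose_mat W) ((- e) \<cdot>\<^sub>m 1\<^sub>m p)"
  let ?N = "four_block_mat (e \<cdot>\<^sub>m 1\<^sub>m k) (0\<^sub>m k p) (transpose_mat W) (1\<^sub>m p)"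
  have "?M * ?N = four_block_mat (B * (e \<cdot>\<^sub>m 1\<^sub>m k) + W * transpose_mat W) (B * 0\<^sub>m k p + W * 1\<^sub>m p)
     (transpose_mat W * (e \<cdot>\<^sub>m 1\<^sub>m k) + ((- e) \<cdot>\<^sub>m 1\<^sub>m p) * transpose_mat W)
     (transpose_mat W * 0\<^sub>m k p + ((- e) \<cdot>\<^sub>m 1\<^sub>m p) * 1\<^sub>m p)"
    using B W by (intro mult_four_block_mat) auto
  also have "\<dots> = four_block_mat (e \<cdot>\<^sub>m B + W * transpose_mat W) W (0\<^sub>m p k) ((- e) \<cdot>\<^sub>m 1\<^sub>m p)"
    using B W
    by (intro cong_four_block_mat)
      (auto simp: mult_smult_distrib[where nr = k and n = k and nc = k]
        mult_smult_distrib[where nr = p and n = k and nc = k]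
        mult_smult_assoc_mat[where nr = p and n = p and nc = k])
  finally have prod: "?M * ?N = \<dots>" .
  have "det (?M * ?N) = det ?M * det ?N" using B W by (intro det_mult[where n = "k + p"]) auto
  moreover have "det ?N = e ^ k"
    using W by (simp add: det_four_block_mat_upper_right_zero[where n = k and m = p])
  moreover have "det (?M * ?N) = det (e \<cdot>\<^sub>m B + W * transpose_mat W) * (- e) ^ p"
    unfolding prod using B W
    by (subst det_four_block_mat_lower_left_zero[where n = k and m = p]) auto
  ultimately show ?thesis by (simp add: mult.commute)
qed

lemma submatrix_add_gram:
  assumes A: "A \<in> carrier_mat n n" and V: "V \<in> carrier_mat n p" and X: "X \<subseteq> {..<n}"
  shows "submatrix (e \<cdot>\<^sub>m A + V * transpose_mat V) X X
    = e \<cdot>\<^sub>m submatrix A X X + submatrix V X UNIV * transpose_mat (submatrix V X UNIV :: real mat)"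
proof -
  have lt: "pick X i < n" if "i < card X" for i using pick_in_set that X by blast
  show ?thesis
    using A V X lt
    by (intro eq_matI)
      (auto simp: dim_submatrix restrict_index_set submatrix_index row_submatrix_UNIV)
qed

lemma minor_tendsto_gram_minor:
  assumes A: "A \<in> carrier_mat n n" and V: "V \<in> carrier_mat n p" and X: "X \<subseteq> {..<n}"
  shows "((\<lambda>e. det (submatrix (e \<cdot>\<^sub>m A + V * transpose_mat V) X X))
    \<longlongrightarrow> det (submatrix (V * transpose_mat V) X X)) (at_right (0::real))"
proof (rule tendsto_det[where k = "card X"])
  fix i j assume ij: "i < card X" "j < card X"
  then have lt: "pick X i < n" "pick X j < n" using pick_in_set X by blast+
  have "submatrix (e \<cdot>\<^sub>m A + V * transpose_mat V) X X $$ (i, j)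
      = e * A $$ (pick X i, pick X j) + submatrix (V * transpose_mat V) X X $$ (i, j)" for e
    using A V X ij lt by (simp add: submatrix_index restrict_index_set)
  moreover have "((\<lambda>e. e * A $$ (pick X i, pick X j) + submatrix (V * transpose_mat V) X X $$ (i, j))
      \<longlongrightarrow> submatrix (V * transpose_mat V) X X $$ (i, j)) (at_right 0)"
    by (auto intro!: tendsto_eq_intros)
  ultimately show "((\<lambda>e. submatrix (e \<cdot>\<^sub>m A + V * transpose_mat V) X X $$ (i, j))
      \<longlongrightarrow> submatrix (V * transpose_mat V) X X $$ (i, j)) (at_right (0::real))"
    by (simp only:)
next
  show "submatrix (e \<cdot>\<^sub>m A + V * transpose_mat V) X X \<in> carrier_mat (card X) (card X)" for e
    using A V X by (intro carrier_matI) (simp_all add: dim_submatrix restrict_index_set)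
  show "submatrix (V * transpose_mat V) X X \<in> carrier_mat (card X) (card X)"
    using V X by (intro carrier_matI) (simp_all add: dim_submatrix restrict_index_set)
qed

text \<open>
  For \<open>e > 0\<close> the scaled minor equals a bordered determinant with lower right block \<open>-eI\<close>, which is
  continuous in \<open>e\<close> up to \<open>e = 0\<close>.
\<close>

lemma scaled_minor_tendsto_ext_weight:
  assumes A: "A \<in> carrier_mat n n" and V: "V \<in> carrier_mat n p" and X: "X \<subseteq> {..<n}"
  shows "((\<lambda>e. e ^ p / e ^ card X * det (submatrix (e \<cdot>\<^sub>m A + V * transpose_mat V) X X))
    \<longlongrightarrow> ext_weight p A V X) (at_right (0::real))"
proof -
  let ?k = "card X" and ?W = "submatrix V X UNIV" and ?B = "submatrix A X X"
  let ?M = "\<lambda>e. four_block_mat ?B ?W (transpose_mat ?W) ((- e) \<cdot>\<^sub>m 1\<^sub>m p)"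
  have B: "?B \<in> carrier_mat ?k ?k" and W: "?W \<in> carrier_mat ?k p"
    using A V X by (auto intro!: carrier_matI simp: dim_submatrix restrict_index_set)
  have "((\<lambda>e. det (?M e)) \<longlongrightarrow> det (four_block_mat ?B ?W (transpose_mat ?W) (0\<^sub>m p p))) (at_right 0)"
  proof (rule tendsto_det[where k = "?k + p"])
    fix i j assume ij: "i < ?k + p" "j < ?k + p"
    have "((\<lambda>e. - e * c) \<longlongrightarrow> 0) (at_right 0)" for c :: real
      by (auto intro!: tendsto_eq_intros)
    then show "((\<lambda>e. ?M e $$ (i, j))
        \<longlongrightarrow> four_block_mat ?B ?W (transpose_mat ?W) (0\<^sub>m p p) $$ (i, j)) (at_right 0)"
      using B W ij by simp
  qed (use B in auto)
  then have "((\<lambda>e. (- 1) ^ p * det (?M e)) \<longlongrightarrow> ext_weight p A V X) (at_right 0)"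
    unfolding ext_weight_def Let_def by (intro tendsto_mult tendsto_const)
  moreover have "\<forall>\<^sub>F e in at_right 0. (- 1) ^ p * det (?M e)
      = e ^ p / e ^ ?k * det (submatrix (e \<cdot>\<^sub>m A + V * transpose_mat V) X X)"
    using eventually_at_right_less[of "0::real"]
  proof eventually_elim
    case (elim e)
    have "(- 1) ^ p * (e ^ ?k * det (?M e))
        = ((- 1) * (- e)) ^ p * det (submatrix (e \<cdot>\<^sub>m A + V * transpose_mat V) X X)"
      unfolding det_add_gram_eq_bordered[OF B W] submatrix_add_gram[OF A V X] power_mult_distrib
      by simp
    then show ?case using elim by (simp add: field_simps)
  qed
  ultimately show ?thesis by (rule Lim_transform_eventually)
qed

section \<open>The limit of the fixed-size L-ensembles\<close>

theorem theorem4p1: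
  fixes n p m :: nat
    and V A :: "real mat"
    and D :: "real \<Rightarrow> nat set pmf"
  assumes "full_column_rank n p V" and "p < n"
    and "symmetric_mat n A" and "vec_space.rank n A = n"
    and "\<forall>\<^sub>F e in at_right 0. psd_mat n (e \<cdot>\<^sub>m A + V * transpose_mat V)"
    and "m \<le> n"
    and "\<forall>\<^sub>F e in at_right 0. fixed_size_L_ensemble n m (e \<cdot>\<^sub>m A + V * transpose_mat V) (D e)"
  shows "\<exists>D'. converges_in_distribution n D D' (at_right 0) \<and>
      (if m \<le> p then fixed_size_L_ensemble n m (V * transpose_mat V) D'
       else fixed_size_ext_L_ensemble n p m A V D')"
proof -
  have V: "V \<in> carrier_mat n p" and A: "A \<in> carrier_mat n n"
    using assms(1,3) by (auto simp: full_column_rank_def symmetric_mat_def)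
  have inj: "v = 0\<^sub>v p" if "v \<in> carrier_vec p" "V *\<^sub>v v = 0\<^sub>v n" for v
    using full_column_rank_injective[OF assms(1)] that by blast
  have law: "\<forall>\<^sub>F e in at_right 0.
      fixed_size_law n m (\<lambda>X. det (submatrix (e \<cdot>\<^sub>m A + V * transpose_mat V) X X)) (D e)"
    using assms(7) by eventually_elim (simp add: fixed_size_L_ensemble_def)
  show ?thesis
  proof (cases "m \<le> p")
    case True
    obtain X where X: "X \<subseteq> {..<n}" "card X = m"
      and indep: "\<And>x. x \<in> carrier_vec n \<Longrightarrow> supported_on X x \<Longrightarrow> transpose_mat V *\<^sub>v x = 0\<^sub>v p
        \<Longrightarrow> x = 0\<^sub>v n"
      using exists_independent_rows[OF V inj True] by blast
    have nonzero: "det (submatrix (V * transpose_mat V) X X) \<noteq> 0"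
    proof (rule principal_minor_nonzero[OF _ X(1)])
      fix x assume x: "x \<in> carrier_vec n" "supported_on X x"
        and iso: "x \<bullet> ((V * transpose_mat V) *\<^sub>v x) = 0"
      have "(transpose_mat V *\<^sub>v x) \<bullet> (transpose_mat V *\<^sub>v x) = 0"
        using iso quadratic_form_gram[OF V x(1)] by simp
      then have "transpose_mat V *\<^sub>v x = 0\<^sub>v p"
        using V x by (intro scalar_prod_self_eq_zeroD) auto
      then show "x = 0\<^sub>v n" using indep x by blast
    qed (use V in simp)
    obtain D' where "converges_in_distribution n D D' (at_right 0)"
      and "fixed_size_law n m (\<lambda>X. det (submatrix (V * transpose_mat V) X X)) D'"
    proof (rule fixed_size_law_limit[OF trivial_limit_at_right_real law])
      show "\<forall>\<^sub>F e in at_right 0. (0::real) < 1" by simp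
      show "((\<lambda>e. 1 * det (submatrix (e \<cdot>\<^sub>m A + V * transpose_mat V) Z Z))
          \<longlongrightarrow> det (submatrix (V * transpose_mat V) Z Z)) (at_right 0)"
        if "Z \<subseteq> {..<n}" for Z
        using minor_tendsto_gram_minor[OF A V that] by simp
    qed (use X nonzero in auto)
    then show ?thesis using True gram_psd[OF V] by (auto simp: fixed_size_L_ensemble_def)
  next
    case False
    have "\<forall>\<^sub>F e in at_right 0. e > 0 \<and> psd_mat n (e \<cdot>\<^sub>m A + V * transpose_mat V)"
      using assms(5) eventually_at_right_less by (rule eventually_conj[rotated])
    then obtain e where e: "e > 0" "psd_mat n (e \<cdot>\<^sub>m A + V * transpose_mat V)"
      using eventually_happens' trivial_limit_at_right_real by blast
    note pos_def = pos_def_on_kernel[OF V A assms(4) e]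
    obtain Y where Y: "Y \<subseteq> {..<n}" "card Y = p"
      and indep: "\<And>x. x \<in> carrier_vec n \<Longrightarrow> supported_on Y x \<Longrightarrow> transpose_mat V *\<^sub>v x = 0\<^sub>v p
        \<Longrightarrow> x = 0\<^sub>v n"
      using exists_independent_rows[OF V inj order_refl] by blast
    obtain X where X: "Y \<subseteq> X" "X \<subseteq> {..<n}" "card X = m"
      using exists_subset_between[of Y m "{..<n}"] Y False assms(6) by auto
    have nonzero: "ext_weight p A V X \<noteq> 0"
      using pos_def(2) independent_rows_span[OF V Y indep] X
      by (intro ext_weight_nonzero[OF A V X(2)]) blast+
    obtain D' where "converges_in_distribution n D D' (at_right 0)"
      and "fixed_size_law n m (ext_weight p A V) D'"
    proof (rule fixed_size_law_limit[OF trivial_limit_at_right_real law])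
      show "\<forall>\<^sub>F e in at_right 0. e ^ p / e ^ m > (0::real)"
        using eventually_at_right_less[of "0::real"] by eventually_elim simp
      show "((\<lambda>e. e ^ p / e ^ m * det (submatrix (e \<cdot>\<^sub>m A + V * transpose_mat V) Z Z))
          \<longlongrightarrow> ext_weight p A V Z) (at_right 0)" if "Z \<subseteq> {..<n}" "card Z = m" for Z
        using scaled_minor_tendsto_ext_weight[OF A V that(1)] that(2) by simp
    qed (use X nonzero in auto)
    moreover have "nonneg_pair n p A V"
      using assms(1-3) pos_def(1) by (simp add: nonneg_pair_def)
    ultimately show ?thesis using False by (auto simp: fixed_size_ext_L_ensemble_def)
  qed
qed

end
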